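(* Let $k\ge 1$ and let $\mathcal{G}_1,\mathcal{G}_2,\ldots,\mathcal{G}_k$ be compatible sets of connected bipartite graphs. Then there exists a (nonempty) family of finite polyhedra such that every face of each of these polyhedra is a $2k$-gon, and the links at the vertices are isomorphic to the graphs from $\mathcal{G}_1,\mathcal{G}_2,\ldots,\mathcal{G}_k$; that is, every link at a vertex is isomorphic (as an ordinary graph) to a graph belonging to some $\mathcal{G}_i$, and every graph belonging to some $\mathcal{G}_i$ occurs, up to isomorphism, as the link at some vertex.
   Context: A polyhedron is a two-dimensional complex obtained from several oriented $p$-gons by identification of corresponding sides (each side of a polygon is a labelled, oriented edge; sides with the same label are identified respecting orientation). It is finite if it is obtained from finitely many polygons. The polygons are its faces. For a vertex of the polyhedron, the link at this vertex is the graph obtained by intersecting the polyhedron with a sphere of small radius centred at the vertex. A bipartite graph is a graph whose vertex set is partitioned into two disjoint subsets, the black vertices and the white vertices, such that no two vertices in the same subset lie on a common edge. The graphs are finite and simple, each has at least one edge, and each $\mathcal{G}_i$ is a finite nonempty set of pairwise disjoint graphs. Sets $\mathcal{G}_1,\ldots,\mathcal{G}_k$ of connected bipartite graphs are called compatible if the total number of white vertices of all graphs of $\mathcal{G}_i$ is equal to the same number $n$ for every $i=1,\ldots,k$, and for every $j=2,\ldots,k$ there is a bijection from the set of all white vertices of graphs in $\mathcal{G}_1$ to the set of all white vertices of graphs in $\mathcal{G}_j$ preserving the degrees of vertices. *)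

theory Defs
  imports Main
begin

section \<open>Graphs\<close>

text \<open>
  Links may a priori contain loops and multiple edges, so edges are abstract objects with a set
  of endpoints; a loop has a singleton set of endpoints.
\<close>

record ('v, 'e) graph =
  verts :: "'v set"
  edges :: "'e set"
  ends :: "'e \<Rightarrow> 'v set"

definition graph_iso :: "('v, 'e) graph \<Rightarrow> ('w, 'd) graph \<Rightarrow> bool" where
  "graph_iso G H \<longleftrightarrow> (\<exists>\<phi> \<psi>. bij_betw \<phi> (verts G) (verts H) \<and> bij_betw \<psi> (edges G) (edges H) \<and>
     (\<forall>e\<in>edges G. ends H (\<psi> e) = \<phi> ` ends G e))"

text \<open>A simple graph with a black/white colouring; an edge is the two-element set of its endpoints.\<close>

record 'a bgraph =
  white :: "'a set"
  black :: "'a set"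
  bedges :: "'a set set"

definition bverts :: "'a bgraph \<Rightarrow> 'a set" where
  "bverts G = white G \<union> black G"

definition bipartite_graph :: "'a bgraph \<Rightarrow> bool" where
  "bipartite_graph G \<longleftrightarrow>
     finite (bverts G) \<and> white G \<inter> black G = {} \<and> bedges G \<noteq> {} \<and>
     (\<forall>e\<in>bedges G. \<exists>w\<in>white G. \<exists>b\<in>black G. e = {w, b})"

definition connected_bgraph :: "'a bgraph \<Rightarrow> bool" where
  "connected_bgraph G \<longleftrightarrow>
     (\<forall>u\<in>bverts G. \<forall>v\<in>bverts G. (u, v) \<in> {(x, y). {x, y} \<in> bedges G}\<^sup>*)"

definition bdegree :: "'a bgraph \<Rightarrow> 'a \<Rightarrow> nat" where
  "bdegree G v = card {e \<in> bedges G. v \<in> e}"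

definition underlying_graph :: "'a bgraph \<Rightarrow> ('a, 'a set) graph" where
  "underlying_graph G = \<lparr>verts = bverts G, edges = bedges G, ends = (\<lambda>e. e)\<rparr>"

definition bgraph_collection :: "'a bgraph set \<Rightarrow> bool" where
  "bgraph_collection \<G> \<longleftrightarrow>
     finite \<G> \<and> \<G> \<noteq> {} \<and>
     (\<forall>G\<in>\<G>. bipartite_graph G \<and> connected_bgraph G) \<and>
     pairwise (\<lambda>G H. disjnt (bverts G) (bverts H)) \<G>"

definition whites :: "'a bgraph set \<Rightarrow> 'a set" where
  "whites \<G> = (\<Union>G\<in>\<G>. white G)"

text \<open>
  The degree of a white vertex is taken in the graph of the collection that contains it, which is
  unique because the graphs of a collection are pairwise disjoint.
\<close>

definition compatible :: "nat \<Rightarrow> (nat \<Rightarrow> 'a bgraph set) \<Rightarrow> bool" where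
  "compatible k \<G> \<longleftrightarrow>
     (\<exists>n. \<forall>i\<in>{1..k}. (\<Sum>G\<in>\<G> i. card (white G)) = n) \<and>
     (\<forall>j\<in>{2..k}. \<exists>f. bij_betw f (whites (\<G> 1)) (whites (\<G> j)) \<and>
        (\<forall>G\<in>\<G> 1. \<forall>H\<in>\<G> j. \<forall>w\<in>white G. f w \<in> white H \<longrightarrow> bdegree H (f w) = bdegree G w))"


section \<open>Polyhedra\<close>

text \<open>
  A polyhedron is given by its gluing data. The sides of a polygon \<^term>\<open>f\<close>, read along the
  orientation of \<^term>\<open>f\<close>, form the list \<^term>\<open>bdry P f\<close>. A side consists of a label and a flag;
  the flag is \<^term>\<open>True\<close> iff the labelled side is directed along the orientation of the polygon.
  Polygons are indexed, so several of them may carry the same boundary word.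
\<close>

record ('f, 'l) polyhedron =
  faces :: "'f set"
  bdry :: "'f \<Rightarrow> ('l \<times> bool) list"

definition polyhedron :: "('f, 'l) polyhedron \<Rightarrow> bool" where
  "polyhedron P \<longleftrightarrow> faces P \<noteq> {} \<and> (\<exists>p>0. \<forall>f\<in>faces P. length (bdry P f) = p)"

definition finite_polyhedron :: "('f, 'l) polyhedron \<Rightarrow> bool" where
  "finite_polyhedron P \<longleftrightarrow> polyhedron P \<and> finite (faces P)"

text \<open>
  The pair \<^term>\<open>(f, i)\<close> with \<^term>\<open>i < length (bdry P f)\<close> denotes both the \<open>i\<close>-th side of
  \<^term>\<open>f\<close> and the corner of \<^term>\<open>f\<close> at which that side begins; the side runs from corner
  \<open>i\<close> to corner \<open>i + 1\<close>, cyclically.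
\<close>

definition sides :: "('f, 'l) polyhedron \<Rightarrow> ('f \<times> nat) set" where
  "sides P = {(f, i). f \<in> faces P \<and> i < length (bdry P f)}"

definition corners :: "('f, 'l) polyhedron \<Rightarrow> ('f \<times> nat) set" where
  "corners P = {(f, i). f \<in> faces P \<and> i < length (bdry P f)}"

fun label :: "('f, 'l) polyhedron \<Rightarrow> 'f \<times> nat \<Rightarrow> 'l" where
  "label P (f, i) = fst (bdry P f ! i)"

fun tail_corner :: "('f, 'l) polyhedron \<Rightarrow> 'f \<times> nat \<Rightarrow> 'f \<times> nat" where
  "tail_corner P (f, i) =
     (if snd (bdry P f ! i) then (f, i) else (f, Suc i mod length (bdry P f)))"

fun head_corner :: "('f, 'l) polyhedron \<Rightarrow> 'f \<times> nat \<Rightarrow> 'f \<times> nat" where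
  "head_corner P (f, i) =
     (if snd (bdry P f ! i) then (f, Suc i mod length (bdry P f)) else (f, i))"

text \<open>
  Identifying two sides with the same label along their directions identifies their tails and
  their heads. The vertices of the polyhedron are the classes of corners under the equivalence
  relation generated by this; the relation \<open>glued\<close> is symmetric, so its reflexive transitive
  closure is that equivalence relation. The edges of the polyhedron are the labels.
\<close>

definition glued :: "('f, 'l) polyhedron \<Rightarrow> (('f \<times> nat) \<times> ('f \<times> nat)) set" where
  "glued P =
     {(tail_corner P s, tail_corner P t) | s t. s \<in> sides P \<and> t \<in> sides P \<and> label P s = label P t} \<union>
     {(head_corner P s, head_corner P t) | s t. s \<in> sides P \<and> t \<in> sides P \<and> label P s = label P t}"

definition vertices :: "('f, 'l) polyhedron \<Rightarrow> ('f \<times> nat) set set" where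
  "vertices P = corners P // (glued P)\<^sup>*"

text \<open>
  A small sphere around a vertex \<^term>\<open>v\<close> meets an edge of the polyhedron in one point near each
  end of that edge lying at \<^term>\<open>v\<close> (hence in two points if the edge is a loop), and it meets the
  polygons in one arc for each corner belonging to \<^term>\<open>v\<close>. These points and arcs are the vertices
  and edges of the link. The arc at a corner joins the points on the two sides meeting there.
\<close>

datatype 'l edge_end = Tail 'l | Head 'l

definition edge_ends_at :: "('f, 'l) polyhedron \<Rightarrow> ('f \<times> nat) set \<Rightarrow> 'l edge_end set" where
  "edge_ends_at P C =
     {Tail (label P s) | s. s \<in> sides P \<and> tail_corner P s \<in> C} \<union>
     {Head (label P s) | s. s \<in> sides P \<and> head_corner P s \<in> C}"

definition link :: "('f, 'l) polyhedron \<Rightarrow> ('f \<times> nat) set \<Rightarrow> ('l edge_end, 'f \<times> nat) graph" where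
  "link P v = \<lparr>verts = edge_ends_at P v, edges = v, ends = (\<lambda>c. edge_ends_at P {c})\<rparr>"

end

theory Submission
  imports Defs "HOL-Library.Nat_Bijection"
begin

text \<open>
  All collections \<open>\<G> i\<close> have equally many edges: an edge is determined by its white end and one
  of the edges there, and the white vertices of different collections correspond with equal degrees.
  More precisely, the edges of every \<open>\<G> i\<close> can be indexed by one finite set \<open>F\<close> in such a way that
  whether two indices have the same white end does not depend on \<open>i\<close>
  (\<open>compatible_edge_indexing\<close>). The elements of \<open>F\<close> become the faces of a single polyhedron.

  Let \<open>e\<^sub>i\<close> be the edge of \<open>\<G> i\<close> with index \<open>f\<close>. Going around the \<open>2k\<close>-gon \<open>f\<close>, let the sides
  carry, in turn, the black end of \<open>e\<^sub>1\<close>, the white end of \<open>e\<^sub>1\<close>, the black end of \<open>e\<^sub>2\<close>, the white end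
  of \<open>e\<^sub>2\<close>, and so on up to the white end of \<open>e\<^sub>k\<close>. All sides are directed along the polygon, and the
  label of a side also records its position, so only sides in the same position are glued.

  At the corner between the two sides coming from \<open>e\<^sub>i\<close>, two polygons are glued along an adjacent
  side iff their edges \<open>e\<^sub>i\<close> share the black or the white end. At the corner preceding those sides,
  the incoming side is white and comes from \<open>e\<^sub>i\<^sub>-\<^sub>1\<close>, or from \<open>e\<^sub>k\<close> if \<open>i = 1\<close>; by the choice of the
  indexing it is glued exactly as a side labelled with the white end of \<open>e\<^sub>i\<close> would be. So at either
  corner the classes of corners are the classes of edges of \<open>\<G> i\<close> generated by adjacency. As the
  graphs of \<open>\<G> i\<close> are disjoint and connected, such a class consists of the edges of one graph
  (\<open>glued_class_eq\<close>). The link has these edges as arcs and their ends as points, so it is that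
  graph (\<open>link_iso\<close>), and every graph of \<open>\<G> i\<close> is obtained in this way.
\<close>

section \<open>Collections of connected bipartite graphs\<close>

definition collection_edges :: "'a bgraph set \<Rightarrow> 'a set set" where
  "collection_edges \<G> = (\<Union>G\<in>\<G>. bedges G)"

definition blacks :: "'a bgraph set \<Rightarrow> 'a set" where
  "blacks \<G> = (\<Union>G\<in>\<G>. black G)"

definition white_end :: "'a bgraph set \<Rightarrow> 'a set \<Rightarrow> 'a" where
  "white_end \<G> e = the_elem (e \<inter> whites \<G>)"

definition black_end :: "'a bgraph set \<Rightarrow> 'a set \<Rightarrow> 'a" where
  "black_end \<G> e = the_elem (e \<inter> blacks \<G>)"

lemma bedge_subset_bverts:
  assumes "bipartite_graph G" "e \<in> bedges G"
  shows "e \<subseteq> bverts G"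
  using assms unfolding bipartite_graph_def bverts_def by fastforce

lemma graph_of_collection_eqI:
  assumes "bgraph_collection \<G>" "G \<in> \<G>" "H \<in> \<G>" "x \<in> bverts G" "x \<in> bverts H"
  shows "G = H"
  using assms unfolding bgraph_collection_def pairwise_def disjnt_iff by blast

lemma whites_disjoint_blacks:
  assumes "bgraph_collection \<G>"
  shows "whites \<G> \<inter> blacks \<G> = {}"
proof -
  have False if "G \<in> \<G>" "H \<in> \<G>" "x \<in> white G" "x \<in> black H" for G H x
  proof -
    have "G = H"
      using graph_of_collection_eqI[OF assms that(1,2)] that(3,4) by (auto simp: bverts_def)
    with that assms show False
      unfolding bgraph_collection_def bipartite_graph_def by blast
  qed
  then show ?thesis unfolding whites_def blacks_def by blast
qed

lemma
  assumes "bgraph_collection \<G>" "e \<in> collection_edges \<G>"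
  shows edge_eq_ends: "e = {white_end \<G> e, black_end \<G> e}"
    and white_end_in_whites: "white_end \<G> e \<in> whites \<G>"
    and black_end_in_blacks: "black_end \<G> e \<in> blacks \<G>"
proof -
  obtain G where G: "G \<in> \<G>" "e \<in> bedges G"
    using assms(2) unfolding collection_edges_def by blast
  then obtain w b where wb: "w \<in> white G" "b \<in> black G" "e = {w, b}"
    using assms(1) unfolding bgraph_collection_def bipartite_graph_def by metis
  have w: "w \<in> whites \<G>" and b: "b \<in> blacks \<G>"
    using G wb unfolding whites_def blacks_def by blast+
  have "e \<inter> whites \<G> = {w}" "e \<inter> blacks \<G> = {b}"
    using w b wb(3) whites_disjoint_blacks[OF assms(1)] by auto
  then have "white_end \<G> e = w" "black_end \<G> e = b"
    unfolding white_end_def black_end_def by simp_all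
  with w b wb(3) show "e = {white_end \<G> e, black_end \<G> e}"
    and "white_end \<G> e \<in> whites \<G>" and "black_end \<G> e \<in> blacks \<G>"
    by simp_all
qed

lemma white_end_neq_black_end:
  assumes "bgraph_collection \<G>" "e \<in> collection_edges \<G>" "e' \<in> collection_edges \<G>"
  shows "white_end \<G> e \<noteq> black_end \<G> e'"
  using white_end_in_whites[OF assms(1,2)] black_end_in_blacks[OF assms(1,3)]
    whites_disjoint_blacks[OF assms(1)] by auto

lemma finite_collection_edges:
  assumes "bgraph_collection \<G>"
  shows "finite (collection_edges \<G>)"
proof -
  have "finite (bedges G)" if "G \<in> \<G>" for G
  proof (rule finite_subset)
    show "bedges G \<subseteq> Pow (bverts G)"
      using assms that bedge_subset_bverts unfolding bgraph_collection_def by blast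
    show "finite (Pow (bverts G))"
      using assms that unfolding bgraph_collection_def bipartite_graph_def by simp
  qed
  with assms show ?thesis unfolding collection_edges_def bgraph_collection_def by blast
qed

lemma collection_edges_nonempty:
  assumes "bgraph_collection \<G>"
  shows "collection_edges \<G> \<noteq> {}"
  using assms unfolding collection_edges_def bgraph_collection_def bipartite_graph_def by blast

text \<open>
  A link has no isolated points, so it can only be isomorphic to a graph without isolated vertices.
\<close>

lemma bverts_eq_Union_bedges:
  assumes "bipartite_graph G" "connected_bgraph G"
  shows "bverts G = \<Union>(bedges G)"
proof
  show "\<Union>(bedges G) \<subseteq> bverts G"
    using bedge_subset_bverts[OF assms(1)] by blast
  show "bverts G \<subseteq> \<Union>(bedges G)"
  proof
    fix v assume v: "v \<in> bverts G"
    obtain e where "e \<in> bedges G" using assms(1) unfolding bipartite_graph_def by blast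
    moreover then have "e \<noteq> {}" using assms(1) unfolding bipartite_graph_def by auto
    ultimately obtain w where e: "e \<in> bedges G" "w \<in> e" by blast
    then have "w \<in> bverts G" using bedge_subset_bverts[OF assms(1)] by blast
    then have "(v, w) \<in> {(x, y). {x, y} \<in> bedges G}\<^sup>*"
      using assms(2) v unfolding connected_bgraph_def by blast
    then show "v \<in> \<Union>(bedges G)"
      by (cases rule: converse_rtranclE) (use e in auto)
  qed
qed

text \<open>
  Since the graphs are disjoint, a white vertex meets no edge of another graph; its degree is
  therefore the size of its fibre under \<^const>\<open>white_end\<close> on the whole collection.
\<close>

lemma bdegree_eq_card_fibre:
  assumes "bgraph_collection \<G>" "G \<in> \<G>" "w \<in> white G"
  shows "bdegree G w = card {e \<in> collection_edges \<G>. white_end \<G> e = w}"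
proof -
  have w: "w \<in> whites \<G>" using assms unfolding whites_def by blast
  have "e \<in> bedges G \<and> w \<in> e \<longleftrightarrow> e \<in> collection_edges \<G> \<and> white_end \<G> e = w" for e
  proof
    assume e: "e \<in> bedges G \<and> w \<in> e"
    then have E: "e \<in> collection_edges \<G>" using assms unfolding collection_edges_def by blast
    then have "w \<in> {white_end \<G> e, black_end \<G> e}" using edge_eq_ends[OF assms(1) E] e by simp
    moreover have "w \<noteq> black_end \<G> e"
      using w black_end_in_blacks[OF assms(1) E] whites_disjoint_blacks[OF assms(1)] by blast
    ultimately show "e \<in> collection_edges \<G> \<and> white_end \<G> e = w" using E by simp
  next
    assume e: "e \<in> collection_edges \<G> \<and> white_end \<G> e = w"
    then have "w \<in> e" using edge_eq_ends[OF assms(1)] by blast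
    obtain H where H: "H \<in> \<G>" "e \<in> bedges H"
      using e unfolding collection_edges_def by blast
    then have "w \<in> bverts H"
      using \<open>w \<in> e\<close> assms(1) bedge_subset_bverts unfolding bgraph_collection_def by blast
    then have "H = G"
      using graph_of_collection_eqI[OF assms(1) H(1) assms(2)] assms(3) by (simp add: bverts_def)
    with H \<open>w \<in> e\<close> show "e \<in> bedges G \<and> w \<in> e" by simp
  qed
  then show ?thesis unfolding bdegree_def by simp
qed

section \<open>Matching the edges of compatible collections\<close>

text \<open>
  A bijection of base sets under which corresponding fibres have equal size lifts to the total
  sets: glue together bijections between the fibres.
\<close>

lemma ex_bij_betw_over_bij:
  assumes fin: "finite A" "finite B"
    and h: "bij_betw h X Y"
    and \<alpha>: "\<alpha> ` A \<subseteq> X" and \<beta>: "\<beta> ` B \<subseteq> Y"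
    and fibres: "\<And>x. x \<in> X \<Longrightarrow> card {a \<in> A. \<alpha> a = x} = card {b \<in> B. \<beta> b = h x}"
  shows "\<exists>e. bij_betw e A B \<and> (\<forall>a\<in>A. \<beta> (e a) = h (\<alpha> a))"
proof -
  have "\<exists>g. bij_betw g {a \<in> A. \<alpha> a = x} {b \<in> B. \<beta> b = h x}" if "x \<in> X" for x
    using finite_same_card_bij[OF _ _ fibres[OF that]] fin by auto
  then obtain g where g: "\<And>x. x \<in> X \<Longrightarrow> bij_betw (g x) {a \<in> A. \<alpha> a = x} {b \<in> B. \<beta> b = h x}"
    by metis
  define e where "e a = g (\<alpha> a) a" for a
  have e: "e a \<in> B \<and> \<beta> (e a) = h (\<alpha> a)" if "a \<in> A" for a
    using bij_betwE[OF g[of "\<alpha> a"]] \<alpha> that unfolding e_def by blast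
  have "inj_on e A"
  proof (rule inj_onI)
    fix a a' assume a: "a \<in> A" "a' \<in> A" "e a = e a'"
    then have "h (\<alpha> a) = h (\<alpha> a')" using e by metis
    then have "\<alpha> a = \<alpha> a'" using h \<alpha> a(1,2) by (auto simp: bij_betw_def dest: inj_onD)
    then show "a = a'"
      using a g[of "\<alpha> a"] \<alpha> unfolding e_def bij_betw_def inj_on_def by auto
  qed
  moreover have "b \<in> e ` A" if b: "b \<in> B" for b
  proof -
    obtain x where x: "x \<in> X" "\<beta> b = h x" using h \<beta> b unfolding bij_betw_def by blast
    then have "b \<in> g x ` {a \<in> A. \<alpha> a = x}" using g[OF x(1)] b unfolding bij_betw_def by blast
    then show ?thesis unfolding e_def by auto
  qed
  ultimately have "bij_betw e A B" using e unfolding bij_betw_def by blast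
  with e show ?thesis by blast
qed

text \<open>
  Compatibility relates \<open>\<G> 1\<close> only to the collections with index at least 2; including \<open>i = 1\<close>,
  with the identity, lets all collections be treated alike.
\<close>

lemma compatible_white_bijection:
  assumes coll: "\<forall>i\<in>{1..k}. bgraph_collection (\<G> i)" and "compatible k \<G>" and i: "i \<in> {1..k}"
  shows "\<exists>h. bij_betw h (whites (\<G> 1)) (whites (\<G> i)) \<and>
    (\<forall>w\<in>whites (\<G> 1). card {e \<in> collection_edges (\<G> 1). white_end (\<G> 1) e = w}
                      = card {e \<in> collection_edges (\<G> i). white_end (\<G> i) e = h w})"
proof (cases "i = 1")
  case True
  then show ?thesis by (intro exI[of _ id]) simp
next
  case False
  then have "i \<in> {2..k}" using i by auto
  then obtain h where h: "bij_betw h (whites (\<G> 1)) (whites (\<G> i))"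
    and deg: "\<forall>G\<in>\<G> 1. \<forall>H\<in>\<G> i. \<forall>w\<in>white G. h w \<in> white H \<longrightarrow> bdegree H (h w) = bdegree G w"
    using assms(2) unfolding compatible_def by blast
  have c1: "bgraph_collection (\<G> 1)" and ci: "bgraph_collection (\<G> i)"
    using coll i by auto
  have "card {e \<in> collection_edges (\<G> 1). white_end (\<G> 1) e = w}
      = card {e \<in> collection_edges (\<G> i). white_end (\<G> i) e = h w}" if "w \<in> whites (\<G> 1)" for w
  proof -
    obtain G where G: "G \<in> \<G> 1" "w \<in> white G" using \<open>w \<in> whites (\<G> 1)\<close> unfolding whites_def by blast
    have "h w \<in> whites (\<G> i)" using h \<open>w \<in> whites (\<G> 1)\<close> by (rule bij_betw_apply)
    then obtain H where H: "H \<in> \<G> i" "h w \<in> white H" unfolding whites_def by blast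
    have "bdegree H (h w) = bdegree G w" using deg G H by blast
    then show ?thesis
      using bdegree_eq_card_fibre[OF c1 G] bdegree_eq_card_fibre[OF ci H] by simp
  qed
  with h show ?thesis by blast
qed

text \<open>
  The indexing of \<open>\<G> i\<close> is an enumeration of the edges of \<open>\<G> 1\<close> followed by a lift of the bijection
  of white vertices. The latter makes the partition of the indices by white ends common to all
  \<open>i\<close>, so that one label can serve a white side in two neighbouring collections.
\<close>

lemma compatible_edge_indexing:
  assumes "k \<ge> 1" and coll: "\<forall>i\<in>{1..k}. bgraph_collection (\<G> i)" and "compatible k \<G>"
  obtains N and \<epsilon> :: "nat \<Rightarrow> nat \<Rightarrow> 'a set" where
    "N > 0"
    and "\<And>i. i \<in> {1..k} \<Longrightarrow> bij_betw (\<epsilon> i) {..<N} (collection_edges (\<G> i))"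
    and "\<And>i j f f'. \<lbrakk>i \<in> {1..k}; j \<in> {1..k}; f < N; f' < N\<rbrakk> \<Longrightarrow>
      white_end (\<G> i) (\<epsilon> i f) = white_end (\<G> i) (\<epsilon> i f') \<longleftrightarrow>
      white_end (\<G> j) (\<epsilon> j f) = white_end (\<G> j) (\<epsilon> j f')"
proof -
  have c1: "bgraph_collection (\<G> 1)" using assms(1) coll by simp
  define N where "N = card (collection_edges (\<G> 1))"
  obtain d where d: "bij_betw d {..<N} (collection_edges (\<G> 1))"
    using ex_bij_betw_nat_finite[OF finite_collection_edges[OF c1]]
    by (auto simp: N_def atLeast0LessThan)
  have "\<exists>h m. bij_betw h (whites (\<G> 1)) (whites (\<G> i)) \<and>
      bij_betw m (collection_edges (\<G> 1)) (collection_edges (\<G> i)) \<and>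
      (\<forall>e\<in>collection_edges (\<G> 1). white_end (\<G> i) (m e) = h (white_end (\<G> 1) e))"
    if i: "i \<in> {1..k}" for i
  proof -
    have ci: "bgraph_collection (\<G> i)" using coll i by simp
    obtain h where h: "bij_betw h (whites (\<G> 1)) (whites (\<G> i))"
      and fib: "\<forall>w\<in>whites (\<G> 1). card {e \<in> collection_edges (\<G> 1). white_end (\<G> 1) e = w}
                      = card {e \<in> collection_edges (\<G> i). white_end (\<G> i) e = h w}"
      using compatible_white_bijection[OF coll assms(3) i] by blast
    show ?thesis
      using ex_bij_betw_over_bij[OF finite_collection_edges[OF c1] finite_collection_edges[OF ci] h,
          of "white_end (\<G> 1)" "white_end (\<G> i)"] fib h
        white_end_in_whites[OF c1] white_end_in_whites[OF ci] by blast
  qed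
  then obtain h m where hm: "\<And>i. i \<in> {1..k} \<Longrightarrow> bij_betw (h i) (whites (\<G> 1)) (whites (\<G> i)) \<and>
      bij_betw (m i) (collection_edges (\<G> 1)) (collection_edges (\<G> i)) \<and>
      (\<forall>e\<in>collection_edges (\<G> 1). white_end (\<G> i) (m i e) = h i (white_end (\<G> 1) e))"
    by metis
  define \<epsilon> where "\<epsilon> i = m i \<circ> d" for i
  have dE: "d f \<in> collection_edges (\<G> 1)" if "f < N" for f
    using bij_betwE[OF d] that by blast
  have ker: "white_end (\<G> i) (\<epsilon> i f) = white_end (\<G> i) (\<epsilon> i f') \<longleftrightarrow>
      white_end (\<G> 1) (d f) = white_end (\<G> 1) (d f')" if "i \<in> {1..k}" "f < N" "f' < N" for i f f'
  proof -
    have "inj_on (h i) (whites (\<G> 1))" using hm[OF that(1)] by (simp add: bij_betw_def)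
    then show ?thesis
      using hm[OF that(1)] dE that(2,3) white_end_in_whites[OF c1] by (simp add: \<epsilon>_def inj_on_eq_iff)
  qed
  show thesis
  proof
    show "N > 0"
      using collection_edges_nonempty[OF c1] finite_collection_edges[OF c1]
      by (simp add: N_def card_gt_0_iff)
    show "bij_betw (\<epsilon> i) {..<N} (collection_edges (\<G> i))" if "i \<in> {1..k}" for i
      unfolding \<epsilon>_def using bij_betw_trans[OF d] hm[OF that] by blast
    show "white_end (\<G> i) (\<epsilon> i f) = white_end (\<G> i) (\<epsilon> i f') \<longleftrightarrow>
      white_end (\<G> j) (\<epsilon> j f) = white_end (\<G> j) (\<epsilon> j f')"
      if "i \<in> {1..k}" "j \<in> {1..k}" "f < N" "f' < N" for i j f f'
      using ker that by simp
  qed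
qed

section \<open>Polygons glued position by position\<close>

text \<open>
  Polygons with \<open>m\<close> sides, all directed along the orientation, whose labels determine the position
  of the side. Gluing then never mixes positions, so each corner position can be studied separately.
\<close>

locale aligned_gluing =
  fixes F :: "'f set" and m :: nat and lab :: "nat \<Rightarrow> 'f \<Rightarrow> 'l"
  assumes m_pos: "m > 0"
    and lab_position: "\<lbrakk>s < m; s' < m; f \<in> F; f' \<in> F; lab s f = lab s' f'\<rbrakk> \<Longrightarrow> s = s'"
begin

definition P :: "('f, 'l) polyhedron" where
  "P = \<lparr>faces = F, bdry = (\<lambda>f. map (\<lambda>s. (lab s f, True)) [0..<m])\<rparr>"

definition prev :: "nat \<Rightarrow> nat" where
  "prev s = (if s = 0 then m - 1 else s - 1)"

lemma P_simps [simp]: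
  "faces P = F" "length (bdry P f) = m"
  "s < m \<Longrightarrow> label P (f, s) = lab s f"
  "s < m \<Longrightarrow> tail_corner P (f, s) = (f, s)"
  "s < m \<Longrightarrow> head_corner P (f, s) = (f, Suc s mod m)"
  by (simp_all add: P_def)

text \<open>
  The defining equations would unfold a side into the list of labels, out of reach of the rules above.
\<close>

declare label.simps [simp del] tail_corner.simps [simp del] head_corner.simps [simp del]

lemma sides_P: "sides P = F \<times> {..<m}"
  and corners_P: "corners P = F \<times> {..<m}"
  unfolding sides_def corners_def by auto

lemma prev_less: "prev s < m" if "s < m"
  using that m_pos by (auto simp: prev_def)

lemma Suc_prev_mod: "Suc (prev s) mod m = s" if "s < m"
  using that by (auto simp: prev_def)

lemma prev_Suc_mod: "prev (Suc s mod m) = s" if "s < m"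
  using that by (cases "Suc s = m") (auto simp: prev_def)

lemma edge_ends_at_corner:
  assumes "f \<in> F" "s < m"
  shows "edge_ends_at P {(f, s)} = {Tail (lab s f), Head (lab (prev s) f)}"
proof -
  have "{Tail (label P c) |c. c \<in> sides P \<and> tail_corner P c \<in> {(f, s)}} = {Tail (lab s f)}"
    using assms by (auto simp: sides_P intro!: exI[of _ f] exI[of _ s])
  moreover have "Suc t mod m = s \<longleftrightarrow> t = prev s" if "t < m" for t
    using Suc_prev_mod[OF assms(2)] prev_Suc_mod[OF that] by auto
  then have "{Head (label P c) |c. c \<in> sides P \<and> head_corner P c \<in> {(f, s)}}
      = {Head (lab (prev s) f)}"
    using assms(1) prev_less[OF assms(2)]
    by (auto simp: sides_P intro!: exI[of _ f] exI[of _ "prev s"])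
  ultimately show ?thesis by (simp only: edge_ends_at_def insert_is_Un[symmetric])
qed

lemma edge_ends_at_Union: "edge_ends_at Q C = (\<Union>c\<in>C. edge_ends_at Q {c})"
  unfolding edge_ends_at_def by blast

text \<open>
  A corner in position \<open>s\<close> is the tail of side \<open>s\<close> and the head of side \<open>prev s\<close>, and of no other
  side, so these are the two ways in which it can be glued.
\<close>

lemma glued_P_iff:
  "((f, s), c) \<in> glued P \<longleftrightarrow>
   (\<exists>f'. c = (f', s) \<and> s < m \<and> f \<in> F \<and> f' \<in> F \<and>
     (lab s f = lab s f' \<or> lab (prev s) f = lab (prev s) f'))"
  (is "?L \<longleftrightarrow> ?R")
proof
  assume ?L
  then consider
    g t g' t' where "g \<in> F" "t < m" "g' \<in> F" "t' < m" "lab t g = lab t' g'"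
      "(f, s) = (g, t)" "c = (g', t')"
  | g t g' t' where "g \<in> F" "t < m" "g' \<in> F" "t' < m" "lab t g = lab t' g'"
      "(f, s) = (g, Suc t mod m)" "c = (g', Suc t' mod m)"
    unfolding glued_def sides_P by fastforce
  then show ?R
  proof cases
    case 1
    then show ?thesis using lab_position by auto
  next
    case 2
    have "t = t'" using lab_position[OF 2(2,4,1,3,5)] .
    with 2 show ?thesis using prev_Suc_mod m_pos by auto
  qed
next
  assume ?R
  then obtain f' where f': "c = (f', s)" "s < m" "f \<in> F" "f' \<in> F"
    and lab: "lab s f = lab s f' \<or> lab (prev s) f = lab (prev s) f'" by blast
  from lab show ?L
  proof
    assume "lab s f = lab s f'"
    then show ?L unfolding glued_def sides_P using f'
      by (intro UnI1 CollectI exI[of _ "(f, s)"] exI[of _ "(f', s)"]) simp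
  next
    assume "lab (prev s) f = lab (prev s) f'"
    then show ?L unfolding glued_def sides_P using f' prev_less[OF f'(2)] Suc_prev_mod[OF f'(2)]
      by (intro UnI2 CollectI exI[of _ "(f, prev s)"] exI[of _ "(f', prev s)"]) simp
  qed
qed

end

text \<open>
  A fixed corner position \<open>s\<close>, with the faces indexing the edges of a collection, such that the
  outgoing side is glued according to the end \<open>p\<close> of the edge and the incoming side according to the
  other end \<open>q\<close>. Which of the ends is the white one is left open, because both arrangements occur
  around a polygon. The labels are tied to \<open>p\<close> and \<open>q\<close> only through the gluing they cause, as the label
  of the incoming side may come from a vertex of another collection.
\<close>

locale corner_over_collection = aligned_gluing F m lab
  for F :: "'f set" and m :: nat and lab :: "nat \<Rightarrow> 'f \<Rightarrow> 'l" +
  fixes s :: nat and \<G> :: "'a bgraph set" and \<epsilon> :: "'f \<Rightarrow> 'a set" and p q :: "'f \<Rightarrow> 'a"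
  assumes s_less: "s < m"
    and collection: "bgraph_collection \<G>"
    and edge_bij: "bij_betw \<epsilon> F (collection_edges \<G>)"
    and edge_ends: "f \<in> F \<Longrightarrow> \<epsilon> f = {p f, q f}"
    and ends_distinct: "\<lbrakk>f \<in> F; f' \<in> F\<rbrakk> \<Longrightarrow> p f \<noteq> q f'"
    and out_label: "\<lbrakk>f \<in> F; f' \<in> F\<rbrakk> \<Longrightarrow> lab s f = lab s f' \<longleftrightarrow> p f = p f'"
    and in_label: "\<lbrakk>f \<in> F; f' \<in> F\<rbrakk> \<Longrightarrow> lab (prev s) f = lab (prev s) f' \<longleftrightarrow> q f = q f'"
begin

definition corner_class :: "'a bgraph \<Rightarrow> ('f \<times> nat) set" where
  "corner_class G = {f \<in> F. \<epsilon> f \<in> bedges G} \<times> {s}"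

lemma glued_at_iff_adjacent:
  assumes "f \<in> F"
  shows "((f, s), c) \<in> glued P \<longleftrightarrow> (\<exists>f'\<in>F. c = (f', s) \<and> \<epsilon> f \<inter> \<epsilon> f' \<noteq> {})"
proof -
  have "\<epsilon> f \<inter> \<epsilon> f' \<noteq> {} \<longleftrightarrow> p f = p f' \<or> q f = q f'" if "f' \<in> F" for f'
    using edge_ends[OF assms] edge_ends[OF that] ends_distinct[OF assms that]
      ends_distinct[OF that assms] by auto
  then show ?thesis
    unfolding glued_P_iff using assms s_less out_label in_label by auto
qed

lemma bipartite: "G \<in> \<G> \<Longrightarrow> bipartite_graph G"
  and connected: "G \<in> \<G> \<Longrightarrow> connected_bgraph G"
  using collection unfolding bgraph_collection_def by blast+

lemma face_of_edge:
  assumes "G \<in> \<G>" "e \<in> bedges G"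
  obtains f where "f \<in> F" "\<epsilon> f = e"
proof -
  have "e \<in> \<epsilon> ` F"
    using assms bij_betw_imp_surj_on[OF edge_bij] by (auto simp: collection_edges_def)
  with that show thesis by auto
qed

lemma same_graph_if_adjacent:
  assumes "f \<in> F" "f' \<in> F" "G \<in> \<G>" "\<epsilon> f \<in> bedges G" "\<epsilon> f \<inter> \<epsilon> f' \<noteq> {}"
  shows "\<epsilon> f' \<in> bedges G"
proof -
  have "\<epsilon> f' \<in> collection_edges \<G>" using edge_bij assms(2) by (rule bij_betw_apply)
  then obtain H where H: "H \<in> \<G>" "\<epsilon> f' \<in> bedges H" unfolding collection_edges_def by blast
  obtain x where "x \<in> \<epsilon> f" "x \<in> \<epsilon> f'" using assms(5) by blast
  then have "x \<in> bverts G" "x \<in> bverts H"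
    using bedge_subset_bverts[OF bipartite] assms(3,4) H by blast+
  then have "G = H" using graph_of_collection_eqI[OF collection assms(3) H(1)] by blast
  with H show ?thesis by simp
qed

text \<open>
  One inclusion holds because gluing cannot leave a graph, the graphs being disjoint; the other one
  follows a path in the connected graph \<open>G\<close>, whose consecutive edges belong to glued corners.
\<close>

lemma glued_class_eq:
  assumes "G \<in> \<G>" "f \<in> F" "\<epsilon> f \<in> bedges G"
  shows "(glued P)\<^sup>* `` {(f, s)} = corner_class G"
proof
  have "c \<in> corner_class G" if "((f, s), c) \<in> (glued P)\<^sup>*" for c
    using that
  proof (induction rule: rtrancl_induct)
    case base
    then show ?case using assms by (simp add: corner_class_def)
  next
    case (step c d)
    then obtain g where "c = (g, s)" "g \<in> F" "\<epsilon> g \<in> bedges G"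
      unfolding corner_class_def by blast
    with step(2) show ?case
      using glued_at_iff_adjacent[of g d] same_graph_if_adjacent[OF _ _ assms(1)]
      unfolding corner_class_def by blast
  qed
  then show "(glued P)\<^sup>* `` {(f, s)} \<subseteq> corner_class G" by blast
next
  \<comment> \<open>Quantifying over all faces at the end of the path makes the induction on its length work.\<close>
  have reach: "((f, s), (g, s)) \<in> (glued P)\<^sup>*"
    if "(p f, y) \<in> {(x, y). {x, y} \<in> bedges G}\<^sup>*" "g \<in> F" "y \<in> \<epsilon> g" for y g
    using that
  proof (induction arbitrary: g rule: rtrancl_induct)
    case base
    then have "\<epsilon> f \<inter> \<epsilon> g \<noteq> {}" using edge_ends[OF assms(2)] by blast
    with base show ?case using glued_at_iff_adjacent[OF assms(2)] by blast
  next
    case (step y z)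
    then obtain g' where g': "g' \<in> F" "\<epsilon> g' = {y, z}" using face_of_edge[OF assms(1)] by blast
    then have "((f, s), (g', s)) \<in> (glued P)\<^sup>*" using step.IH by blast
    moreover have "((g', s), (g, s)) \<in> glued P"
      using glued_at_iff_adjacent[OF g'(1)] g'(2) step.prems by blast
    ultimately show ?case by (rule rtrancl_into_rtrancl)
  qed
  show "corner_class G \<subseteq> (glued P)\<^sup>* `` {(f, s)}"
  proof
    fix c assume "c \<in> corner_class G"
    then obtain g where g: "c = (g, s)" "g \<in> F" "\<epsilon> g \<in> bedges G" unfolding corner_class_def by blast
    have "p f \<in> bverts G" "p g \<in> bverts G"
      using bedge_subset_bverts[OF bipartite[OF assms(1)]] g assms edge_ends by blast+
    then have "(p f, p g) \<in> {(x, y). {x, y} \<in> bedges G}\<^sup>*"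
      using connected[OF assms(1)] unfolding connected_bgraph_def by blast
    then show "c \<in> (glued P)\<^sup>* `` {(f, s)}" using reach[OF _ g(2)] edge_ends[OF g(2)] g(1) by blast
  qed
qed

lemma corner_class_vertex:
  assumes "G \<in> \<G>"
  shows "corner_class G \<in> vertices P"
proof -
  obtain e where "e \<in> bedges G" using bipartite[OF assms] unfolding bipartite_graph_def by blast
  then obtain f where f: "f \<in> F" "\<epsilon> f \<in> bedges G" using face_of_edge[OF assms] by metis
  then show ?thesis
    using quotientI[of "(f, s)" "corners P" "(glued P)\<^sup>*"] glued_class_eq[OF assms] s_less
    unfolding vertices_def corners_P by simp
qed

lemma corner_class_of:
  assumes "f \<in> F"
  shows "\<exists>G\<in>\<G>. (glued P)\<^sup>* `` {(f, s)} = corner_class G"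
proof -
  have "\<epsilon> f \<in> collection_edges \<G>" using edge_bij assms by (rule bij_betw_apply)
  then obtain G where "G \<in> \<G>" "\<epsilon> f \<in> bedges G" unfolding collection_edges_def by blast
  then show ?thesis using glued_class_eq[OF _ assms] by auto
qed

text \<open>
  An arc of the link is a corner, that is, an edge of \<open>G\<close>. The tail point on an outgoing side goes to
  the common \<open>p\<close>-end of all edges with that label, and the head point on an incoming side to their
  \<open>q\<close>-end; this is injective because labels and ends have the same fibres and no \<open>p\<close>-end is a
  \<open>q\<close>-end.
\<close>

lemma link_iso:
  assumes "G \<in> \<G>"
  shows "graph_iso (link P (corner_class G)) (underlying_graph G)"
proof -
  define A where "A = {f \<in> F. \<epsilon> f \<in> bedges G}"
  have AF: "A \<subseteq> F" unfolding A_def by blast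
  \<comment> \<open>\<open>inv_into\<close> picks some face carrying the label; its end does not depend on the choice.\<close>
  define \<phi> where "\<phi> x = (case x of Tail l \<Rightarrow> p (inv_into F (lab s) l)
                                 | Head l \<Rightarrow> q (inv_into F (lab (prev s)) l))" for x
  have \<phi>: "\<phi> (Tail (lab s f)) = p f" "\<phi> (Head (lab (prev s) f)) = q f" if "f \<in> F" for f
  proof -
    have "inv_into F (lab t) (lab t f) \<in> F" "lab t (inv_into F (lab t) (lab t f)) = lab t f" for t
      using that by (simp_all add: inv_into_into f_inv_into_f)
    then show "\<phi> (Tail (lab s f)) = p f" "\<phi> (Head (lab (prev s) f)) = q f"
      using iffD1[OF out_label[OF _ that]] iffD1[OF in_label[OF _ that]] by (simp_all add: \<phi>_def)
  qed
  have ends: "edge_ends_at P {(f, s)} = {Tail (lab s f), Head (lab (prev s) f)}" if "f \<in> A" for f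
    using edge_ends_at_corner s_less that AF by blast
  have verts: "edge_ends_at P (corner_class G) =
      (\<Union>f\<in>A. {Tail (lab s f), Head (lab (prev s) f)})"
    by (subst edge_ends_at_Union) (auto simp: corner_class_def A_def[symmetric] ends)
  have \<phi>_ends: "\<phi> ` edge_ends_at P {(f, s)} = \<epsilon> f" if "f \<in> A" for f
    using that AF ends \<phi> edge_ends by auto
  have \<epsilon>A: "\<epsilon> ` A = bedges G"
  proof
    show "bedges G \<subseteq> \<epsilon> ` A"
      unfolding A_def by (auto elim: face_of_edge[OF assms])
  qed (auto simp: A_def)
  have "inj_on \<phi> (edge_ends_at P (corner_class G))"
    unfolding verts inj_on_def using subsetD[OF AF] ends_distinct
    by (auto simp: \<phi> out_label in_label dest: sym)
  moreover have "\<phi> ` edge_ends_at P (corner_class G) = \<Union>(\<epsilon> ` A)"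
    unfolding verts using AF \<phi> edge_ends by (auto simp: subset_iff image_UN)
  ultimately have "bij_betw \<phi> (edge_ends_at P (corner_class G)) (bverts G)"
    using \<epsilon>A bverts_eq_Union_bedges[OF bipartite[OF assms] connected[OF assms]]
    by (simp add: bij_betw_def)
  moreover have "bij_betw (\<epsilon> \<circ> fst) (corner_class G) (bedges G)"
  proof (rule bij_betw_trans)
    show "bij_betw fst (corner_class G) A"
      by (auto simp: corner_class_def A_def bij_betw_def inj_on_def)
    show "bij_betw \<epsilon> A (bedges G)"
      using inj_on_subset[OF bij_betw_imp_inj_on[OF edge_bij] AF] \<epsilon>A by (simp add: bij_betw_def)
  qed
  moreover have "(\<epsilon> \<circ> fst) c = \<phi> ` edge_ends_at P {c}" if "c \<in> corner_class G" for c
  proof -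
    obtain f where "f \<in> A" "c = (f, s)"
      using \<open>c \<in> corner_class G\<close> by (auto simp: corner_class_def A_def)
    then show ?thesis using \<phi>_ends[of f] by simp
  qed
  ultimately show ?thesis
    unfolding graph_iso_def link_def underlying_graph_def
    by (intro exI[of _ \<phi>] exI[of _ "\<epsilon> \<circ> fst"]) simp
qed

end

section \<open>The polyhedron with prescribed links\<close>

theorem theorem1:
  fixes k :: nat and \<G> :: "nat \<Rightarrow> 'a bgraph set"
  assumes "k \<ge> 1"
    and "\<forall>i\<in>{1..k}. bgraph_collection (\<G> i)"
    and "compatible k \<G>"
  shows "\<exists>\<P> :: (nat, nat) polyhedron set. \<P> \<noteq> {} \<and>
    (\<forall>P\<in>\<P>. finite_polyhedron P \<and>
       (\<forall>f\<in>faces P. length (bdry P f) = 2 * k) \<and>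
       (\<forall>v\<in>vertices P. \<exists>i\<in>{1..k}. \<exists>G\<in>\<G> i. graph_iso (link P v) (underlying_graph G)) \<and>
       (\<forall>i\<in>{1..k}. \<forall>G\<in>\<G> i. \<exists>v\<in>vertices P. graph_iso (link P v) (underlying_graph G)))"
proof -
  obtain N and \<epsilon> :: "nat \<Rightarrow> nat \<Rightarrow> 'a set" where "N > 0"
    and \<epsilon>: "\<And>i. i \<in> {1..k} \<Longrightarrow> bij_betw (\<epsilon> i) {..<N} (collection_edges (\<G> i))"
    and ker: "\<And>i j f f'. \<lbrakk>i \<in> {1..k}; j \<in> {1..k}; f < N; f' < N\<rbrakk> \<Longrightarrow>
      white_end (\<G> i) (\<epsilon> i f) = white_end (\<G> i) (\<epsilon> i f') \<longleftrightarrow>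
      white_end (\<G> j) (\<epsilon> j f) = white_end (\<G> j) (\<epsilon> j f')"
    by (rule compatible_edge_indexing[OF assms]) (rule that, blast+)
  define w b where "w i f = white_end (\<G> i) (\<epsilon> i f)" and "b i f = black_end (\<G> i) (\<epsilon> i f)" for i f
  define pt where "pt t f = (if even t then b (Suc (t div 2)) f else w (Suc (t div 2)) f)" for t f
  \<comment> \<open>Labels are to be natural numbers, so the finitely many vertices in use are numbered.\<close>
  define V where "V = (\<Union>t<2 * k. pt t ` {..<N})"
  have "finite V" unfolding V_def by simp
  then obtain g :: "'a \<Rightarrow> nat" where g: "inj_on g V"
    using finite_imp_inj_to_nat_seg by blast
  define lab where "lab t f = prod_encode (t, g (pt t f))" for t f
  interpret aligned_gluing "{..<N}" "2 * k" lab
    by standard (use assms(1) in \<open>auto simp: lab_def\<close>)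
  have lab_eq: "lab t f = lab t f' \<longleftrightarrow> pt t f = pt t f'" if "t < 2 * k" "f < N" "f' < N" for t f f'
  proof -
    have "pt t f \<in> V" "pt t f' \<in> V" using that unfolding V_def by blast+
    then show ?thesis using inj_on_eq_iff[OF g] by (simp add: lab_def)
  qed
  \<comment> \<open>Corners \<open>2 * j\<close> and \<open>2 * j + 1\<close> both carry the links from \<open>\<G> (Suc j)\<close>.\<close>
  define i where "i t = Suc (t div 2)" for t :: nat
  have i: "i t \<in> {1..k}" if "t < 2 * k" for t using that unfolding i_def by auto
  have corner: "corner_over_collection {..<N} (2 * k) lab t (\<G> (i t)) (\<epsilon> (i t)) (pt t)
      (if even t then w (i t) else b (i t))" if t: "t < 2 * k" for t
  proof unfold_locales
    have c: "bgraph_collection (\<G> (i t))" using assms(2) i[OF t] by blast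
    have E: "\<epsilon> (i t) f \<in> collection_edges (\<G> (i t))" if "f < N" for f
      using bij_betwE[OF \<epsilon>[OF i[OF t]]] that by blast
    show "t < 2 * k" "bgraph_collection (\<G> (i t))"
      "bij_betw (\<epsilon> (i t)) {..<N} (collection_edges (\<G> (i t)))"
      using t c \<epsilon>[OF i[OF t]] by auto
    show "\<epsilon> (i t) f = {pt t f, (if even t then w (i t) else b (i t)) f}" if "f \<in> {..<N}" for f
      using edge_eq_ends[OF c E[of f]] that by (auto simp: pt_def w_def b_def i_def)
    fix f f' assume f: "f \<in> {..<N}" "f' \<in> {..<N}"
    show "pt t f \<noteq> (if even t then w (i t) else b (i t)) f'"
      using white_end_neq_black_end[OF c E E, of f f'] white_end_neq_black_end[OF c E E, of f' f] f
      by (auto simp: pt_def w_def b_def i_def)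
    show "lab t f = lab t f' \<longleftrightarrow> pt t f = pt t f'" using lab_eq t f by simp
    have "pt (prev t) f = pt (prev t) f' \<longleftrightarrow>
       (if even t then w (i t) else b (i t)) f = (if even t then w (i t) else b (i t)) f'"
    proof (cases "even t")
      case True
      \<comment> \<open>The preceding side is white but belongs to the preceding collection (cyclically).\<close>
      then have "odd (prev t)" using assms(1) by (cases "t = 0") (auto simp: prev_def)
      then show ?thesis
        using True ker[OF i[OF prev_less[OF t]] i[OF t], of f f'] f by (simp add: pt_def w_def i_def)
    next
      case False
      then have "even (prev t)" "i (prev t) = i t" by (auto simp: prev_def i_def elim!: oddE)
      then show ?thesis using False by (simp add: pt_def i_def)
    qed
    then show "lab (prev t) f = lab (prev t) f' \<longleftrightarrow>
       (if even t then w (i t) else b (i t)) f = (if even t then w (i t) else b (i t)) f'"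
      using lab_eq prev_less[OF t] f by simp
  qed
  have "finite_polyhedron P"
    using \<open>N > 0\<close> m_pos unfolding finite_polyhedron_def polyhedron_def
    by (auto intro!: exI[of _ "2 * k"])
  moreover have "\<exists>j\<in>{1..k}. \<exists>G\<in>\<G> j. graph_iso (link P v) (underlying_graph G)"
    if "v \<in> vertices P" for v
  proof -
    obtain f t where ft: "f < N" "t < 2 * k" "v = (glued P)\<^sup>* `` {(f, t)}"
      using \<open>v \<in> vertices P\<close> unfolding vertices_def corners_P by (auto elim!: quotientE)
    interpret corner_over_collection "{..<N}" "2 * k" lab t "\<G> (i t)" "\<epsilon> (i t)" "pt t"
      "if even t then w (i t) else b (i t)"
      using corner[OF ft(2)] .
    obtain G where "G \<in> \<G> (i t)" "v = corner_class G" using corner_class_of[of f] ft by auto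
    then show ?thesis using link_iso i[OF ft(2)] by blast
  qed
  moreover have "\<exists>v\<in>vertices P. graph_iso (link P v) (underlying_graph G)"
    if "j \<in> {1..k}" "G \<in> \<G> j" for j G
  proof -
    define t where "t = 2 * (j - 1)"
    have t: "t < 2 * k" "i t = j" using that(1) by (auto simp: t_def i_def)
    interpret corner_over_collection "{..<N}" "2 * k" lab t "\<G> (i t)" "\<epsilon> (i t)" "pt t"
      "if even t then w (i t) else b (i t)"
      using corner[OF t(1)] .
    show ?thesis using corner_class_vertex link_iso that(2) t(2) by blast
  qed
  ultimately show ?thesis by (intro exI[of _ "{P}"]) simp
qed

end
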